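(* For each $s\ge1$ there exists a constant $C>0$ depending only on $s$ and $a$ such that for any $C^1$ mapping $Q:U\to\mathbb R^3$, any function $w\in C^2(U)$ and any non-negative function $\zeta\in C^1_c(U)$, the following inequality holds: $$\begin{aligned}\int_U K[w,Q]|\nabla w|^{2s+2}\zeta^2dx&\le C\sup_{\operatorname{supp}\zeta}(w^2)\Big\{\int_U K[w,Q]\,|D^2w|^2(|\nabla w|^{2s-2}+1)\zeta^2dx\\&\quad+\int_UK[w,Q]\,|\nabla w|^{2s}\Big(|\nabla\zeta|^2+(|w||Q'|+|Q|)^2\zeta^2w^2\Big)dx\Big\}\\&\quad+C\int_U\big(1+|w^2Q|^{2s}\big)|w^2Q|^{2s+2}\zeta^2dx.\end{aligned}$$ Assume, in addition, that $Q$ and $Q'$ are bounded on $U$. Then $$\begin{aligned}\int_U K[w,Q]|\nabla w|^{2s+2}\zeta^2dx&\le CM_w^2\int_UK[w,Q]\,|D^2w|^2|\nabla w|^{2s-2}\zeta^2dx\\&\quad+CM_w^2\int_UK[w,Q]\,|\nabla w|^{2s}\big(|\nabla\zeta|^2+(M_w\mu_Q+M_Q)^2M_w^2\zeta^2\big)dx\\&\quad+C\,{\rm sgn}(s-1)M_w^2\int_UK[w,Q]\,|D^2w|^2\zeta^2dx+C|U|(M_w^2M_Q)^{2s+2}(1+M_w^2M_Q)^{2s},\end{aligned}$$ where $M_w=\sup_{x\in\operatorname{supp}\zeta}|w(x)|$, $M_Q=\sup_{x\in U}|Q(x)|$, $\mu_Q=\sup_{x\in U}|Q'(x)|$.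
   Context: $U\subset\mathbb R^3$ is an open bounded set with $C^1$ boundary; $|U|$ is its Lebesgue measure. $a\in(0,1)$ is the number $a=\alpha_N/(1+\alpha_N)$ for a fixed real $\alpha_N>0$. For $Q:U\to\mathbb R^3$ and $w:U\to\mathbb R$, $$K[w,Q](x)=\big(1+|\nabla w(x)+w^2(x)Q(x)|\big)^{-a},\quad x\in U.$$ $D^2w$ is the Hessian matrix of $w$, $Q'$ is the derivative matrix of $Q$, and $|\cdot|$ of a matrix is the Euclidean (Frobenius) norm. ${\rm sgn}(0)=0$ and ${\rm sgn}(r)=1$ for $r>0$. Convention: $0^0=1$. *)

theory Defs
  imports "HOL-Analysis.Analysis"
begin

text \<open>Continuous differentiability on a set \<open>U\<close>, always used for open \<open>U\<close>
  (so that differentiating \<open>at x\<close> only involves the values of \<open>f\<close> on \<open>U\<close>).\<close>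

definition C1_on :: "('a::real_normed_vector \<Rightarrow> 'b::real_normed_vector) \<Rightarrow> 'a set \<Rightarrow> bool" where
  "C1_on f U \<longleftrightarrow>
     (\<exists>f' :: 'a \<Rightarrow> 'a \<Rightarrow>\<^sub>L 'b.
        (\<forall>x\<in>U. (f has_derivative blinfun_apply (f' x)) (at x)) \<and> continuous_on U f')"

definition gradient :: "(real ^ 'n \<Rightarrow> real) \<Rightarrow> real ^ 'n \<Rightarrow> real ^ 'n" where
  "gradient f x = (\<chi> i. frechet_derivative f (at x) (axis i 1))"

text \<open>The norm of the type \<open>real ^ 'n ^ 'n\<close> is the Frobenius norm.\<close>

definition hessian :: "(real ^ 'n \<Rightarrow> real) \<Rightarrow> real ^ 'n \<Rightarrow> real ^ 'n ^ 'n" where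
  "hessian f x = jacobian (gradient f) (at x)"

definition C2_on :: "(real ^ 'n \<Rightarrow> real) \<Rightarrow> (real ^ 'n) set \<Rightarrow> bool" where
  "C2_on f U \<longleftrightarrow> C1_on f U \<and> C1_on (gradient f) U"

text \<open>A function on \<open>U\<close> is represented by a total function whose values outside \<open>U\<close> are
  irrelevant, hence the restriction to \<open>U\<close> before taking the closure.\<close>

definition supp :: "'a::topological_space set \<Rightarrow> ('a \<Rightarrow> real) \<Rightarrow> 'a set" where
  "supp U f = closure (support_on U f)"

definition C1c_on :: "('a::real_normed_vector \<Rightarrow> real) \<Rightarrow> 'a set \<Rightarrow> bool" where
  "C1c_on f U \<longleftrightarrow> C1_on f U \<and> compact (supp U f) \<and> supp U f \<subseteq> U"

text \<open>Near every boundary point, and after a linear isometric change of coordinates, \<open>U\<close> is the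
  set of points lying strictly above the graph of a \<open>C\<^sup>1\<close> function.\<close>

definition C1_boundary :: "(real ^ 3) set \<Rightarrow> bool" where
  "C1_boundary U \<longleftrightarrow>
     (\<forall>p\<in>frontier U. \<exists>r>0. \<exists>T :: real ^ 3 \<Rightarrow> real ^ 3. \<exists>\<gamma> :: real ^ 2 \<Rightarrow> real.
        orthogonal_transformation T \<and> C1_on \<gamma> UNIV \<and>
        U \<inter> ball p r = {x \<in> ball p r. T x $ 3 > \<gamma> (vector [T x $ 1, T x $ 2])})"

text \<open>Real power with the convention \<open>0\<^sup>0 = 1\<close>; the library has \<open>0 powr 0 = 0\<close>.\<close>

definition powr0 :: "real \<Rightarrow> real \<Rightarrow> real" (infixr "powr0" 80) where
  "x powr0 p = (if p = 0 then 1 else x powr p)"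

definition K :: "real \<Rightarrow> (real ^ 3 \<Rightarrow> real) \<Rightarrow> (real ^ 3 \<Rightarrow> real ^ 3) \<Rightarrow> real ^ 3 \<Rightarrow> real" where
  "K a w Q x = (1 + norm (gradient w x + (w x)\<^sup>2 *\<^sub>R Q x)) powr (- a)"

end

theory Submission
  imports Defs
begin

text \<open>
  Put \<open>v = \<nabla>w\<close>, \<open>t = \<bar>v\<bar>\<close>, \<open>P = w\<^sup>2 Q\<close>, \<open>p = \<bar>P\<bar>\<close>. Where \<open>t < 2 p\<close>, the integrand \<open>K t\<^bsup>2s+2\<^esup> \<zeta>\<^sup>2\<close> is at most
  \<open>4 K t\<^bsup>2s\<^esup> p\<^sup>2 \<zeta>\<^sup>2\<close>, which already occurs on the right-hand side. Where \<open>t \<ge> 2 p\<close>, the factor \<open>K\<close> is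
  comparable to the smooth weight \<open>k = (1 + t\<^sup>2 + p\<^sup>2)\<^bsup>-a/2\<^esup>\<close>, and \<open>k \<le> 3 K\<close> holds everywhere. For the
  weight \<open>k\<close> one integrates the divergence of \<open>w k t\<^bsup>2s\<^esup> \<zeta>\<^sup>2 v\<close>, whose integral vanishes, and absorbs the
  lower order terms by Young's inequality. The result bounds the left-hand side by a multiple of
  \<open>\<integral> K w\<^sup>2 (\<bar>D\<^sup>2w\<bar>\<^sup>2 t\<^bsup>2s-2\<^esup> \<zeta>\<^sup>2 + t\<^bsup>2s\<^esup> (\<bar>\<nabla>\<zeta>\<bar>\<^sup>2 + (\<bar>w\<bar> \<bar>Q'\<bar> + \<bar>Q\<bar>)\<^sup>2 \<zeta>\<^sup>2 w\<^sup>2))\<close>, which implies both inequalities.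
\<close>

section \<open>The divergence theorem for compactly supported fields\<close>

text \<open>On the open set \<open>U - S\<close> the function agrees with 0, so uniqueness of the
  derivative applies.\<close>

lemma has_derivative_outside_support:
  assumes "open U" "closed S" "\<And>x. x \<in> U \<Longrightarrow> x \<notin> S \<Longrightarrow> f x = 0"
    and "(f has_derivative f') (at x)" "x \<in> U" "x \<notin> S"
  shows "f' = (\<lambda>_. 0)"
proof -
  have "((\<lambda>_. 0) has_derivative f') (at x)"
    by (rule has_derivative_transform_within_open[OF assms(4), of "U - S"])
      (use assms in auto)
  then show ?thesis using has_derivative_unique has_derivative_const by blast
qed

text \<open>The whole-space case; functions on an open set \<open>U\<close> are later reduced to it
  by extension by 0.\<close>

lemma integral_directional_derivative_eq_0:
  fixes g :: "'a::euclidean_space \<Rightarrow> real"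
  assumes der: "\<And>x. (g has_derivative g' x) (at x)"
    and cont: "continuous_on UNIV (\<lambda>x. g' x v)"
    and S: "compact S" "\<And>x. x \<notin> S \<Longrightarrow> g x = 0"
  shows "(LINT x|lborel. g' x v) = 0"
proof -
  have off: "g' x v = 0" if "x \<notin> S" for x
    using has_derivative_outside_support[OF open_UNIV compact_imp_closed[OF S(1)] _ der, of x] S(2) that
    by simp
  obtain R where R: "\<And>x. x \<in> S \<Longrightarrow> norm x \<le> R"
    using compact_imp_bounded[OF S(1)] by (auto simp: bounded_iff)
  have "bounded ((\<lambda>x. g' x v) ` S)"
    by (intro compact_imp_bounded compact_continuous_image S continuous_on_subset[OF cont]) auto
  then obtain B0 where B0: "\<And>x. x \<in> S \<Longrightarrow> \<bar>g' x v\<bar> \<le> B0"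
    by (auto simp: bounded_iff)
  \<comment> \<open>If \<open>S\<close> is empty, \<open>B0\<close> may be negative. Off
    \<open>S\<close> the derivative is 0, so the maximum with 0 is a bound everywhere.\<close>
  define B where "B = max B0 0"
  have B: "\<bar>g' x v\<bar> \<le> B" for x
    using B0[of x] off[of x] by (cases "x \<in> S") (auto simp: B_def)
  have [simp]: "B \<ge> 0" by (simp add: B_def)
  \<comment> \<open>By translation invariance the difference quotients \<open>d n\<close> have integral 0; dominated convergence
    transfers this to the derivative.\<close>
  define h where "h n = inverse (real (Suc n))" for n
  have h: "h n > 0" "h n \<le> 1" for n by (auto simp: h_def divide_simps)
  define d where "d n x = (g (x + h n *\<^sub>R v) - g x) / h n" for n x
  have contg: "continuous_on UNIV g"
    by (intro continuous_at_imp_continuous_on ballI has_derivative_continuous[OF der])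
  have bmg[measurable]: "g \<in> borel_measurable borel"
    by (rule borel_measurable_continuous_onI[OF contg])
  have bmg'[measurable]: "(\<lambda>x. g' x v) \<in> borel_measurable borel"
    by (rule borel_measurable_continuous_onI[OF cont])
  have intg: "integrable lborel g"
  proof -
    have "(\<lambda>x. indicator S x *\<^sub>R g x) = g" using S(2) by (auto simp: indicator_def fun_eq_iff)
    then show ?thesis
      using borel_integrable_compact[OF S(1) continuous_on_subset[OF contg]] by simp
  qed
  have transl: "integrable lborel (\<lambda>x. g (x + c))" "(LINT x|lborel. g (x + c)) = (LINT x|lborel. g x)" for c
  proof -
    have "integrable (distr lborel borel ((+) c)) g" using intg by (simp add: lborel_distr_plus)
    then show "integrable lborel (\<lambda>x. g (x + c))"
      by (subst (asm) integrable_distr_eq) (auto simp: add.commute)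
    have "(LINT x|lborel. g x) = (LINT x|distr lborel borel ((+) c). g x)"
      by (simp add: lborel_distr_plus)
    also have "\<dots> = (LINT x|lborel. g (c + x))"
      by (subst integral_distr) auto
    finally show "(LINT x|lborel. g (x + c)) = (LINT x|lborel. g x)" by (simp add: add.commute)
  qed
  have d0: "(LINT x|lborel. d n x) = 0" for n
    unfolding d_def using transl intg by simp
  have line: "((\<lambda>t. g (x + t *\<^sub>R v)) has_derivative (\<lambda>t. t * g' (x + s *\<^sub>R v) v)) (at s within T)" for x s T
  proof -
    have "((\<lambda>t. x + t *\<^sub>R v) has_derivative (\<lambda>t. t *\<^sub>R v)) (at s within T)"
      by (auto intro!: derivative_eq_intros)
    from has_derivative_in_compose[OF this has_derivative_at_withinI[OF der]]
    have "((\<lambda>t. g (x + t *\<^sub>R v)) has_derivative (\<lambda>t. g' (x + s *\<^sub>R v) (t *\<^sub>R v))) (at s within T)" .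
    moreover have "linear (g' (x + s *\<^sub>R v))" using der has_derivative_linear by blast
    ultimately show ?thesis by (simp add: linear_cmul)
  qed
  \<comment> \<open>An integrable majorant independent of \<open>n\<close>. Inside the ball the mean
    value theorem gives \<open>B\<close>; outside it both values of \<open>g\<close> vanish, because
    \<open>h n \<le> 1\<close> moves the point by at most \<open>norm v\<close>.\<close>
  have bound: "\<bar>d n x\<bar> \<le> B * indicator (cball 0 (R + norm v)) x" for n x
  proof (cases "x \<in> cball 0 (R + norm v)")
    case True
    have "\<exists>y\<in>{0<..<h n}. g (x + h n *\<^sub>R v) - g (x + 0 *\<^sub>R v) = (h n - 0) * g' (x + y *\<^sub>R v) v"
      by (rule mvt_simple[OF h(1)]) (rule line)
    then obtain y where "g (x + h n *\<^sub>R v) - g x = h n * g' (x + y *\<^sub>R v) v" by auto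
    then have "d n x = g' (x + y *\<^sub>R v) v" using h(1)[of n] by (simp add: d_def)
    then show ?thesis using B True by simp
  next
    case False
    then have "norm x > R + norm v" by simp
    moreover have "norm (h n *\<^sub>R v) \<le> norm v"
      using h[of n] by (simp add: mult_left_le_one_le)
    moreover have "norm x \<le> norm (x + h n *\<^sub>R v) + norm (h n *\<^sub>R v)"
      using norm_triangle_ineq4[of "x + h n *\<^sub>R v" "h n *\<^sub>R v"] by simp
    ultimately have "norm (x + h n *\<^sub>R v) > R" "norm x > R" using norm_ge_zero[of v] by linarith+
    then have "g (x + h n *\<^sub>R v) = 0" "g x = 0" using R S(2) by force+
    then show ?thesis by (simp add: d_def)
  qed
  have lim: "(\<lambda>n. d n x) \<longlonglongrightarrow> g' x v" for x
  proof -
    have "((\<lambda>t. g (x + t *\<^sub>R v)) has_real_derivative g' x v) (at 0)"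
      using line[where x=x and s=0] by (simp add: has_field_derivative_def mult.commute[of _ "g' x v"])
    then have "((\<lambda>t. (g (x + t *\<^sub>R v) - g x) / t) \<longlongrightarrow> g' x v) (at 0)"
      by (simp add: has_field_derivative_iff)
    moreover have "filterlim h (at 0) sequentially"
      unfolding h_def filterlim_at using LIMSEQ_inverse_real_of_nat by (auto simp del: of_nat_Suc)
    ultimately show ?thesis unfolding d_def
      by (rule filterlim_compose[where g = "\<lambda>t. (g (x + t *\<^sub>R v) - g x) / t" and f = h])
  qed
  have "(\<lambda>n. LINT x|lborel. d n x) \<longlonglongrightarrow> (LINT x|lborel. g' x v)"
  proof (rule integral_dominated_convergence[where w = "\<lambda>x. B * indicator (cball 0 (R + norm v)) x"])
    show "integrable lborel (\<lambda>x. B * indicator (cball 0 (R + norm v)) x :: real)"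
      using borel_integrable_compact[of "cball 0 (R + norm v)" "\<lambda>_. B"] by (simp add: mult.commute)
    show "d n \<in> borel_measurable lborel" for n
      unfolding d_def by measurable
  qed (use bound lim in auto)
  then show ?thesis using LIMSEQ_unique d0 by (metis (lifting) ext tendsto_const)
qed

text \<open>The restrictions of \<open>f\<close> to \<open>U\<close> and to \<open>S\<close>,
  extended by 0, coincide, and a continuous function on a compact set is integrable.\<close>

lemma set_integrable_compact_support:
  fixes f :: "'a::euclidean_space \<Rightarrow> real"
  assumes "compact S" "S \<subseteq> U" "continuous_on U f" "\<And>x. x \<in> U \<Longrightarrow> x \<notin> S \<Longrightarrow> f x = 0"
  shows "set_integrable lborel U f"
proof -
  have "(\<lambda>x. indicator S x *\<^sub>R f x) = (\<lambda>x. indicator U x *\<^sub>R f x)"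
    using assms(2,4) by (auto simp: indicator_def fun_eq_iff)
  then show ?thesis
    unfolding set_integrable_def
    using borel_integrable_compact[OF assms(1) continuous_on_subset[OF assms(3,2)]] by simp
qed

text \<open>Extension by 0 stays differentiable: a point outside \<open>U\<close> lies in the open
  complement of \<open>S\<close>, where the extension is constantly 0. No regularity of the boundary
  enters the argument.\<close>

lemma set_integral_directional_derivative_eq_0:
  fixes f :: "'a::euclidean_space \<Rightarrow> real"
  assumes U: "open U" and S: "compact S" "S \<subseteq> U"
    and der: "\<And>x. x \<in> U \<Longrightarrow> (f has_derivative f' x) (at x)"
    and cont: "continuous_on U (\<lambda>x. f' x v)"
    and zero: "\<And>x. x \<in> U \<Longrightarrow> x \<notin> S \<Longrightarrow> f x = 0"
  shows "(LINT x:U|lborel. f' x v) = 0"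
proof -
  define g where "g x = (if x \<in> U then f x else 0)" for x
  define g' where "g' x = (if x \<in> U then f' x else (\<lambda>_. 0))" for x
  have cS: "closed S" using S compact_imp_closed by blast
  have gz: "g x = 0" if "x \<notin> S" for x using that zero by (auto simp: g_def)
  have der_g: "(g has_derivative g' x) (at x)" for x
  proof (cases "x \<in> U")
    case True
    then show ?thesis
      using has_derivative_transform_within_open[OF der[OF True] U True, of g]
      by (simp add: g_def g'_def)
  next
    case False
    then have "x \<in> - S" using S by auto
    moreover have "((\<lambda>_. 0) has_derivative (\<lambda>_. 0)) (at x)" by simp
    ultimately have "(g has_derivative (\<lambda>_. 0)) (at x)"
      by (intro has_derivative_transform_within_open[of "\<lambda>_. 0" "\<lambda>_. 0" x UNIV "- S" g])
        (use cS gz in auto)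
    then show ?thesis using False by (simp add: g'_def)
  qed
  \<comment> \<open>Two open sets cover the space: \<open>U\<close>, where \<open>g'\<close> is the
    given derivative, and \<open>- S\<close>, where it is 0.\<close>
  have "continuous_on (U \<union> - S) (\<lambda>x. g' x v)"
  proof (rule continuous_on_open_Un[OF U])
    show "continuous_on U (\<lambda>x. g' x v)"
      using cont by (rule continuous_on_eq) (simp add: g'_def)
    have "g' x v = 0" if "x \<notin> S" for x
      using has_derivative_outside_support[OF open_UNIV cS _ der_g, of x] gz that by auto
    then show "continuous_on (- S) (\<lambda>x. g' x v)"
      by (intro continuous_on_eq[OF continuous_on_const[of _ 0]]) auto
  qed (use cS in auto)
  moreover have "U \<union> - S = UNIV" using S by auto
  ultimately have "(LINT x|lborel. g' x v) = 0"
    using integral_directional_derivative_eq_0[OF der_g _ S(1) gz] by simp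
  moreover have "indicator U x *\<^sub>R f' x v = g' x v" for x by (simp add: g'_def indicator_def)
  ultimately show ?thesis by (simp add: set_lebesgue_integral_def)
qed

section \<open>Matrix norms and traces\<close>

lemma norm_matrix_vector_mult_le: "norm (A *v x) \<le> norm A * norm x"
  for A :: "real ^ 'n ^ 'm"
proof -
  \<comment> \<open>Cauchy-Schwarz in every row; the norms of the rows then combine to the Frobenius
    norm.\<close>
  have "norm (A *v x) \<le> norm (\<chi> i. norm (A $ i) * norm x)"
    by (rule norm_le_componentwise_cart)
      (simp add: matrix_vector_mul_component Cauchy_Schwarz_ineq2)
  also have "\<dots> = norm A * norm x"
    by (simp add: norm_vec_def L2_set_left_distrib)
  finally show ?thesis .
qed

text \<open>Each diagonal entry is at most the Frobenius norm. The sharp factor is the square root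
  of the dimension; the cruder one yields the 3 in \<open>A = a + 2 * s + 3\<close> below.\<close>

lemma abs_trace_le: "\<bar>trace A\<bar> \<le> real CARD('n) * norm A" for A :: "real ^ 'n ^ 'n"
proof -
  have "\<bar>trace A\<bar> \<le> (\<Sum>i\<in>UNIV. \<bar>A $ i $ i\<bar>)"
    unfolding trace_def by (rule sum_abs)
  also have "\<dots> \<le> (\<Sum>i\<in>(UNIV :: 'n set). norm A)"
  proof (rule sum_mono)
    show "\<bar>A $ i $ i\<bar> \<le> norm A" for i
      using component_le_norm_cart[of "A $ i" i] Finite_Cartesian_Product.norm_nth_le[of A i] by linarith
  qed
  finally show ?thesis by simp
qed

lemma trace_eq_sum_axis: "trace A = (\<Sum>i\<in>UNIV. (A *v axis i 1) $ i)" for A :: "real ^ 'n ^ 'n"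
  by (simp add: trace_def matrix_vector_mul_component inner_axis)

section \<open>Powers of the norm, with exponent 0 included\<close>

lemma has_derivative_norm_powr:
  fixes y :: "'a::real_inner"
  assumes "p \<ge> 2"
  shows "((\<lambda>y. norm y powr p) has_derivative (\<lambda>h. p * norm y powr0 (p - 2) * (y \<bullet> h))) (at y)"
proof (cases "y = 0")
  case True
  \<comment> \<open>At the origin the claimed derivative is 0. For \<open>norm y < 1\<close> and
    \<open>p \<ge> 2\<close> the power is at most the square of \<open>norm y\<close>, so the
    difference quotient is at most \<open>norm y\<close>.\<close>
  have "((\<lambda>y. norm y powr p) has_derivative (\<lambda>h. 0)) (at (0::'a))"
  proof (rule has_derivativeI_sandwich[where e = 1 and H = norm])
    fix y :: 'a
    assume y: "y \<noteq> 0" "dist y 0 < 1"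
    then have "norm y powr p \<le> norm y powr 2"
      using assms powr_mono'[of 2 p "norm y"] by simp
    also have "norm y powr 2 = norm y * norm y" by (simp add: powr_numeral power2_eq_square)
    finally show "norm (norm y powr p - norm (0::'a) powr p - 0) / norm (y - 0) \<le> norm y"
      using y by (simp add: divide_le_eq)
  qed (auto intro!: tendsto_eq_intros)
  then show ?thesis using True by simp
next
  case False
  have "((\<lambda>y. norm y powr p) has_derivative
      (\<lambda>h. norm y powr p * (0 * ln (norm y) + (sgn y \<bullet> h) * p / norm y))) (at y)"
    using has_derivative_powr[OF has_derivative_norm[OF False] has_derivative_const[of p]] False
    by (simp add: inner_commute)
  moreover have "norm y powr p = norm y powr0 (p - 2) * (norm y * norm y)"
    using False by (simp add: powr0_def powr_diff powr_numeral power2_eq_square)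
  ultimately show ?thesis
    using False by (simp add: sgn_div_norm field_simps)
qed

text \<open>For \<open>p = 0\<close> the function is constantly 1, whereas \<open>powr\<close> would
  jump at the zeros of \<open>f\<close>. The case \<open>s = 1\<close> relies on this at critical
  points of \<open>w\<close>.\<close>

lemma continuous_on_powr0 [continuous_intros]:
  assumes "continuous_on S f" "p \<ge> 0" "\<And>x. x \<in> S \<Longrightarrow> f x \<ge> 0"
  shows "continuous_on S (\<lambda>x. f x powr0 p)"
proof (cases "p = 0")
  case False
  then show ?thesis
    using assms unfolding powr0_def by (auto intro!: continuous_on_powr')
qed (simp add: powr0_def)

lemma powr0_nonneg: "x powr0 p \<ge> 0"
  by (simp add: powr0_def)

text \<open>With \<open>p = 2 * s\<close>, this and \<open>powr0_mult_power4\<close> write the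
  powers of the gradient norm \<open>t\<close> as \<open>n * t\<^sup>2\<close> and
  \<open>n * t ^ 4\<close> with a common factor \<open>n\<close>, so that the later inequalities are
  polynomial in \<open>t\<close>.\<close>

lemma powr0_mult_power2: "x \<ge> 0 \<Longrightarrow> p > 0 \<Longrightarrow> x powr0 (p - 2) * x\<^sup>2 = x powr p"
  by (cases "x = 0"; cases "p = 2") (auto simp: powr0_def powr_diff powr_numeral)

lemma powr0_mult_power4:
  assumes "x \<ge> 0" "p > 0"
  shows "x powr0 (p - 2) * x ^ 4 = x powr (p + 2)"
proof -
  have "x powr0 (p - 2) * x ^ 4 = x powr p * x\<^sup>2"
    using powr0_mult_power2[OF assms] by (simp add: power_eq_if mult_ac)
  also have "\<dots> = x powr (p + 2)"
    using assms by (cases "x = 0") (simp_all add: powr_add)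
  finally show ?thesis .
qed

section \<open>Gradients and Jacobians of continuously differentiable functions\<close>

lemma C1_on_has_frechet_derivative:
  assumes "C1_on f U" "x \<in> U"
  shows "(f has_derivative frechet_derivative f (at x)) (at x)"
  using assms unfolding C1_on_def frechet_derivative_works[symmetric] by (auto intro: differentiableI)

text \<open>\<open>C1_on\<close> provides some continuous family of derivatives; uniqueness
  identifies it with \<open>frechet_derivative\<close>, on which \<open>gradient\<close> and
  \<open>jacobian\<close> are built.\<close>

lemma C1_on_continuous_on_frechet_derivative:
  assumes "C1_on f U"
  shows "continuous_on U (\<lambda>x. frechet_derivative f (at x) v)"
proof -
  obtain f' where f': "\<And>x. x \<in> U \<Longrightarrow> (f has_derivative blinfun_apply (f' x)) (at x)"
    "continuous_on U f'"
    using assms unfolding C1_on_def by blast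
  have "continuous_on U (\<lambda>x. blinfun_apply (f' x) v)"
    using f'(2) by (intro continuous_intros)
  then show ?thesis
    by (rule continuous_on_eq) (simp add: frechet_derivative_at[OF f'(1)])
qed

lemma C1_on_continuous_on: "C1_on f U \<Longrightarrow> continuous_on U f"
  by (intro continuous_at_imp_continuous_on ballI has_derivative_continuous[OF C1_on_has_frechet_derivative])

lemma C1_on_has_derivative_gradient:
  assumes "C1_on f U" "x \<in> U"
  shows "(f has_derivative (\<lambda>h. gradient f x \<bullet> h)) (at x)"
proof -
  have f: "(f has_derivative frechet_derivative f (at x)) (at x)"
    by (rule C1_on_has_frechet_derivative[OF assms])
  then have lin: "linear (frechet_derivative f (at x))" by (rule has_derivative_linear)
  have "frechet_derivative f (at x) h = gradient f x \<bullet> h" for h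
  proof -
    have "frechet_derivative f (at x) h = frechet_derivative f (at x) (\<Sum>i\<in>UNIV. (h $ i) *\<^sub>R axis i 1)"
      by (simp add: basis_expansion flip: scalar_mult_eq_scaleR)
    also have "\<dots> = gradient f x \<bullet> h"
      by (simp add: linear_sum[OF lin] linear_cmul[OF lin] gradient_def inner_vec_def mult.commute)
    finally show ?thesis .
  qed
  then have "frechet_derivative f (at x) = (\<lambda>h. gradient f x \<bullet> h)" ..
  then show ?thesis using f by simp
qed

lemma C1_on_continuous_on_gradient: "C1_on f U \<Longrightarrow> continuous_on U (gradient f)"
  unfolding gradient_def by (intro continuous_intros C1_on_continuous_on_frechet_derivative)

lemma C1_on_has_derivative_jacobian:
  fixes f :: "real ^ 'm \<Rightarrow> real ^ 'n"
  assumes "C1_on f U" "x \<in> U"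
  shows "(f has_derivative (\<lambda>h. jacobian f (at x) *v h)) (at x)"
  using differentiableI[OF C1_on_has_frechet_derivative[OF assms]] by (rule jacobian_works[THEN iffD1])

lemma C1_on_continuous_on_jacobian:
  "C1_on f U \<Longrightarrow> continuous_on U (\<lambda>x. jacobian f (at x))"
  for f :: "real ^ 'm \<Rightarrow> real ^ 'n"
  unfolding jacobian_def matrix_def
  by (intro continuous_intros C1_on_continuous_on_frechet_derivative)

lemma continuous_on_matrix_vector_mult [continuous_intros]:
  fixes A :: "'a::topological_space \<Rightarrow> real ^ 'n ^ 'm"
  assumes "continuous_on S A" "continuous_on S u"
  shows "continuous_on S (\<lambda>x. A x *v u x)"
  unfolding matrix_vector_mult_def using assms by (intro continuous_intros)

text \<open>By the product rule the integrand is the divergence of the field \<open>g\<close> times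
  \<open>u\<close>, that is, the sum over \<open>i\<close> of the derivative of its
  \<open>i\<close>-th component in direction \<open>i\<close>. Each summand has integral 0. The
  compact support comes from the scalar factor \<open>g\<close>.\<close>

lemma set_integral_divergence_eq_0:
  fixes g :: "real ^ 'n \<Rightarrow> real" and u :: "real ^ 'n \<Rightarrow> real ^ 'n"
  assumes U: "open U" and S: "compact S" "S \<subseteq> U"
    and g: "\<And>x. x \<in> U \<Longrightarrow> (g has_derivative g' x) (at x)" "\<And>h. continuous_on U (\<lambda>x. g' x h)"
    and u: "\<And>x. x \<in> U \<Longrightarrow> (u has_derivative (\<lambda>h. A x *v h)) (at x)" "continuous_on U A"
    and zero: "\<And>x. x \<in> U \<Longrightarrow> x \<notin> S \<Longrightarrow> g x = 0"
  shows "set_integrable lborel U (\<lambda>x. g' x (u x) + g x * trace (A x))"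
    and "(LINT x:U|lborel. g' x (u x) + g x * trace (A x)) = 0"
proof -
  define d where "d i x = (\<lambda>h. g x * (A x *v h) $ i + g' x h * u x $ i)" for i x
  have der: "((\<lambda>x. g x * u x $ i) has_derivative d i x) (at x)" if "x \<in> U" for i x
    unfolding d_def
    by (rule has_derivative_mult[OF g(1)[OF that]])
      (rule bounded_linear.has_derivative[OF bounded_linear_vec_nth u(1)[OF that]])
  have cont: "continuous_on U g" "continuous_on U u"
    by (auto intro!: continuous_at_imp_continuous_on has_derivative_continuous g(1) u(1))
  have cont_d: "continuous_on U (\<lambda>x. d i x h)" for i h
    unfolding d_def using cont g(2) u(2) by (intro continuous_intros)
  have "g' x = (\<lambda>_. 0)" if "x \<in> U" "x \<notin> S" for x
    using has_derivative_outside_support[OF U compact_imp_closed[OF S(1)] zero g(1)] that by simp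
  then have int: "set_integrable lborel U (\<lambda>x. d i x (axis i 1))" for i
    by (intro set_integrable_compact_support[OF S cont_d]) (simp add: d_def zero)
  have int0: "(LINT x:U|lborel. d i x (axis i 1)) = 0" for i
    by (rule set_integral_directional_derivative_eq_0[OF U S der cont_d]) (simp_all add: zero)
  have eq: "(\<Sum>i\<in>UNIV. d i x (axis i 1)) = g' x (u x) + g x * trace (A x)" if "x \<in> U" for x
  proof -
    have lin: "linear (g' x)" using g(1)[OF that] by (rule has_derivative_linear)
    have "g' x (u x) = g' x (\<Sum>i\<in>UNIV. (u x $ i) *\<^sub>R axis i 1)"
      by (simp add: basis_expansion flip: scalar_mult_eq_scaleR)
    also have "\<dots> = (\<Sum>i\<in>UNIV. g' x (axis i 1) * u x $ i)"
      by (simp add: linear_sum[OF lin] linear_cmul[OF lin] mult.commute)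
    finally show ?thesis
      by (simp add: d_def sum.distrib trace_eq_sum_axis sum_distrib_left)
  qed
  have "integrable lborel (\<lambda>x. \<Sum>i\<in>UNIV. indicator U x *\<^sub>R d i x (axis i 1))"
    by (rule Bochner_Integration.integrable_sum) (use int in \<open>simp add: set_integrable_def\<close>)
  moreover have "(LINT x|lborel. (\<Sum>i\<in>UNIV. indicator U x *\<^sub>R d i x (axis i 1))) = 0"
    using int int0
    by (subst Bochner_Integration.integral_sum) (simp_all add: set_integrable_def set_lebesgue_integral_def)
  moreover have "(\<Sum>i\<in>UNIV. indicator U x *\<^sub>R d i x (axis i 1))
      = indicator U x *\<^sub>R (g' x (u x) + g x * trace (A x))" for x
    using eq[of x] by (cases "x \<in> U") auto
  ultimately show "set_integrable lborel U (\<lambda>x. g' x (u x) + g x * trace (A x))"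
    and "(LINT x:U|lborel. g' x (u x) + g x * trace (A x)) = 0"
    by (simp_all add: set_integrable_def set_lebesgue_integral_def)
qed

section \<open>Pointwise inequalities\<close>

text \<open>Each of the three lower order terms is split by Young's inequality so as to spend one
  sixth of \<open>k * n * t ^ 4 * z\<^sup>2\<close>. Together they spend one half, which moves to
  the left; doubling then turns 6 into 12.\<close>

lemma absorb_young:
  fixes k n t H W q z y a A d :: real
  assumes nonneg: "k \<ge> 0" "n \<ge> 0" and A: "A \<ge> 1" "0 \<le> a" "a \<le> A"
    and le: "k * n * t ^ 4 * z\<^sup>2
      \<le> d + k * n * t\<^sup>2 * (W * z\<^sup>2 * (A * H + 2 * a * t * q) + 2 * W * z * t * y)"
  shows "k * n * t ^ 4 * z\<^sup>2
    \<le> 2 * d + 12 * A\<^sup>2 * k * (W\<^sup>2 * n * (H\<^sup>2 * z\<^sup>2 + t\<^sup>2 * (q\<^sup>2 * z\<^sup>2 + y\<^sup>2)))"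
proof -
  \<comment> \<open>The second and third splittings produce the coefficients
    \<open>a\<^sup>2\<close> and 1, both replaced by \<open>A\<^sup>2\<close> to reach one common
    constant.\<close>
  have sq: "a\<^sup>2 \<le> A\<^sup>2" "1 \<le> A\<^sup>2" using A by (auto intro: power_mono)
  \<comment> \<open>The completed square gives the coefficient 3/2; it is weakened to 6 to match the
    other two terms.\<close>
  have "t\<^sup>2 * (A * W * H) \<le> t ^ 4 / 6 + 6 * A\<^sup>2 * (W\<^sup>2 * H\<^sup>2)"
  proof -
    have "0 \<le> (t\<^sup>2 - 3 * (A * W * H))\<^sup>2 / 6" by simp
    also have "\<dots> = t ^ 4 / 6 - t\<^sup>2 * (A * W * H) + 3 / 2 * (A\<^sup>2 * (W\<^sup>2 * H\<^sup>2))"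
      by (simp add: power2_eq_square power4_eq_xxxx field_simps)
    moreover have "0 \<le> A\<^sup>2 * (W\<^sup>2 * H\<^sup>2)" by simp
    ultimately show ?thesis by linarith
  qed
  from mult_left_mono[OF this, of "n * z\<^sup>2"] nonneg
  have 1: "n * z\<^sup>2 * (t\<^sup>2 * (A * W * H)) \<le> n * z\<^sup>2 * (t ^ 4 / 6 + 6 * A\<^sup>2 * (W\<^sup>2 * H\<^sup>2))"
    by simp
  have "2 * a * t * W * q \<le> t\<^sup>2 / 6 + 6 * A\<^sup>2 * (W\<^sup>2 * q\<^sup>2)"
  proof -
    have "0 \<le> (t - 6 * (a * W * q))\<^sup>2 / 6" by simp
    also have "\<dots> = t\<^sup>2 / 6 - 2 * a * t * W * q + 6 * (a\<^sup>2 * (W * q)\<^sup>2)"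
      by (simp add: power2_eq_square field_simps)
    finally show ?thesis
      using mult_right_mono[OF sq(1), of "(W * q)\<^sup>2"] by (simp add: power_mult_distrib)
  qed
  from mult_left_mono[OF this, of "n * t\<^sup>2 * z\<^sup>2"] nonneg
  have 2: "n * t\<^sup>2 * z\<^sup>2 * (2 * a * t * W * q) \<le> n * t\<^sup>2 * z\<^sup>2 * (t\<^sup>2 / 6 + 6 * A\<^sup>2 * (W\<^sup>2 * q\<^sup>2))"
    by simp
  have "2 * W * z * t * y \<le> z\<^sup>2 * t\<^sup>2 / 6 + 6 * A\<^sup>2 * (W\<^sup>2 * y\<^sup>2)"
  proof -
    have "0 \<le> (z * t - 6 * (W * y))\<^sup>2 / 6" by simp
    also have "\<dots> = z\<^sup>2 * t\<^sup>2 / 6 - 2 * W * z * t * y + 6 * (1 * (W * y)\<^sup>2)"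
      by (simp add: power2_eq_square field_simps)
    finally show ?thesis
      using mult_right_mono[OF sq(2), of "(W * y)\<^sup>2"] by (simp add: power_mult_distrib)
  qed
  from mult_left_mono[OF this, of "n * t\<^sup>2"] nonneg
  have 3: "n * t\<^sup>2 * (2 * W * z * t * y) \<le> n * t\<^sup>2 * (z\<^sup>2 * t\<^sup>2 / 6 + 6 * A\<^sup>2 * (W\<^sup>2 * y\<^sup>2))"
    by simp
  have "n * t\<^sup>2 * (W * z\<^sup>2 * (A * H + 2 * a * t * q) + 2 * W * z * t * y)
      \<le> n * t ^ 4 * z\<^sup>2 / 2 + 6 * A\<^sup>2 * (W\<^sup>2 * n * (H\<^sup>2 * z\<^sup>2 + t\<^sup>2 * (q\<^sup>2 * z\<^sup>2 + y\<^sup>2)))"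
    (is "?l \<le> ?r")
  proof -
    have "?l = n * z\<^sup>2 * (t\<^sup>2 * (A * W * H)) + n * t\<^sup>2 * z\<^sup>2 * (2 * a * t * W * q)
        + n * t\<^sup>2 * (2 * W * z * t * y)"
      by (simp add: algebra_simps)
    moreover have "?r = n * z\<^sup>2 * (t ^ 4 / 6 + 6 * A\<^sup>2 * (W\<^sup>2 * H\<^sup>2))
        + n * t\<^sup>2 * z\<^sup>2 * (t\<^sup>2 / 6 + 6 * A\<^sup>2 * (W\<^sup>2 * q\<^sup>2))
        + n * t\<^sup>2 * (z\<^sup>2 * t\<^sup>2 / 6 + 6 * A\<^sup>2 * (W\<^sup>2 * y\<^sup>2))"
      by (simp add: power2_eq_square power4_eq_xxxx field_simps)
    ultimately show ?thesis using 1 2 3 by linarith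
  qed
  from mult_left_mono[OF this nonneg(1)] le show ?thesis
    by (simp add: algebra_simps)
qed

text \<open>The decreasing power applied to \<open>x \<le> c * y\<close> leaves the factor
  \<open>c powr b\<close>, which is at most \<open>c\<close> since \<open>b \<le> 1\<close> and
  \<open>c \<ge> 1\<close>. The comparison constants thus do not depend on the exponent.\<close>

lemma powr_minus_le_of_le_mult:
  fixes x y b c :: real
  assumes "0 < x" "0 < y" "x \<le> c * y" "c \<ge> 1" "0 \<le> b" "b \<le> 1"
  shows "y powr - b \<le> c * x powr - b"
proof -
  have "y powr - b = c powr b * (c * y) powr - b"
    using assms by (simp add: powr_mult powr_minus)
  also have "\<dots> \<le> c powr 1 * x powr - b"
    using assms by (intro mult_mono powr_mono powr_mono2') auto
  finally show ?thesis using assms by simp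
qed

text \<open>Here \<open>r\<close> stands for \<open>\<bar>v + P\<bar>\<close>.\<close>

lemma smooth_weight_compare:
  fixes a t p r :: real
  assumes a: "0 \<le> a" "a \<le> 1" and nonneg: "t \<ge> 0" "p \<ge> 0" "r \<ge> 0"
    and r: "r \<le> t + p" "t \<le> r + p"
  shows "(1 + t\<^sup>2 + p\<^sup>2) powr (- a / 2) \<le> 3 * (1 + r) powr - a"
    and "2 * p \<le> t \<Longrightarrow> (1 + r) powr - a \<le> 5 * (1 + t\<^sup>2 + p\<^sup>2) powr (- a / 2)"
proof -
  have pos: "1 + t\<^sup>2 + p\<^sup>2 > 0" by (simp add: add_pos_nonneg)
  \<comment> \<open>After squaring, both weights carry the exponent \<open>- (a / 2)\<close> and
    only their bases have to be compared.\<close>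
  have eq: "(1 + r) powr - a = ((1 + r)\<^sup>2) powr - (a / 2)"
    using nonneg by (simp add: powr_powr flip: powr_numeral)
  have "(1 + r)\<^sup>2 \<le> (1 + (t + p))\<^sup>2"
    using nonneg r by (intro power_mono) auto
  \<comment> \<open>The difference of the two sides is the sum of the squares of
    \<open>1 - t\<close>, \<open>1 - p\<close> and \<open>t - p\<close>.\<close>
  also have "\<dots> \<le> 3 * (1 + t\<^sup>2 + p\<^sup>2)"
    using zero_le_power2[of "1 - t"] zero_le_power2[of "1 - p"] zero_le_power2[of "t - p"]
    by (simp add: power2_eq_square field_simps)
  finally show "(1 + t\<^sup>2 + p\<^sup>2) powr (- a / 2) \<le> 3 * (1 + r) powr - a"
    unfolding eq using powr_minus_le_of_le_mult[of "(1 + r)\<^sup>2" "1 + t\<^sup>2 + p\<^sup>2" 3 "a / 2"] a nonneg pos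
    by simp
  assume p: "2 * p \<le> t"
  \<comment> \<open>From \<open>t \<le> r + p\<close> and \<open>2 * p \<le> t\<close> follow
    \<open>t \<le> 2 * r\<close> and \<open>p \<le> r\<close>, whence the 5 as 4 + 1.\<close>
  then have "t\<^sup>2 \<le> (2 * r)\<^sup>2" "(2 * p)\<^sup>2 \<le> t\<^sup>2"
    using nonneg r by (intro power_mono; linarith)+
  then have "1 + t\<^sup>2 + p\<^sup>2 \<le> 5 * (1 + r)\<^sup>2"
    using nonneg by (simp add: power2_eq_square field_simps)
  then show "(1 + r) powr - a \<le> 5 * (1 + t\<^sup>2 + p\<^sup>2) powr (- a / 2)"
    unfolding eq using powr_minus_le_of_le_mult[of "1 + t\<^sup>2 + p\<^sup>2" "(1 + r)\<^sup>2" 5 "a / 2"] a nonneg pos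
    by simp
qed

text \<open>The letters stand for absolute values and norms at one point: \<open>H\<close> for the
  Hessian, \<open>z\<close> for the cut-off, \<open>y\<close> for its gradient, and \<open>d\<close>
  for a divergence. If \<open>2 * p \<le> t\<close>, the weight \<open>K\<close> is exchanged for
  \<open>k\<close> and \<open>absorb_young\<close> applies; otherwise \<open>t\<^sup>2\<close> is at
  most \<open>4 * p\<^sup>2\<close>, and \<open>p \<le> W * q\<close> places the term on the
  right.\<close>

lemma pointwise_gradient_bound:
  fixes a A k K n t p W H Q Q' q z y d :: real
  assumes nonneg: "0 \<le> k" "0 \<le> K" "0 \<le> n" "0 \<le> t" "0 \<le> p" "0 \<le> W" "0 \<le> Q" "0 \<le> Q'"
    and A: "A \<ge> 1" "0 \<le> a" "a \<le> A"
    and q: "q = W * (W * Q' + Q)" and p: "p = W\<^sup>2 * Q"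
    and K: "k \<le> 3 * K" "2 * p \<le> t \<Longrightarrow> K \<le> 5 * k"
    and le: "k * n * t ^ 4 * z\<^sup>2
      \<le> d + k * n * t\<^sup>2 * (W * z\<^sup>2 * (A * H + 2 * a * t * q) + 2 * W * z * t * y)"
  shows "K * n * t ^ 4 * z\<^sup>2 \<le> 10 * d
    + (180 * A\<^sup>2 + 4) * (K * (W\<^sup>2 * n * (H\<^sup>2 * z\<^sup>2 + t\<^sup>2 * (q\<^sup>2 * z\<^sup>2 + y\<^sup>2))))"
proof -
  define X where "X = W\<^sup>2 * n * (H\<^sup>2 * z\<^sup>2 + t\<^sup>2 * (q\<^sup>2 * z\<^sup>2 + y\<^sup>2))"
  have X: "X \<ge> 0" using nonneg by (simp add: X_def)
  have abs: "k * n * t ^ 4 * z\<^sup>2 \<le> 2 * d + 12 * A\<^sup>2 * (k * X)"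
    using absorb_young[OF nonneg(1,3) A le] by (simp add: X_def mult.assoc)
  have "k * X \<le> 3 * K * X" using K(1) X by (rule mult_right_mono)
  then have "12 * A\<^sup>2 * (k * X) \<le> 12 * A\<^sup>2 * (3 * K * X)" by (rule mult_left_mono) simp
  with abs have kle: "k * n * t ^ 4 * z\<^sup>2 \<le> 2 * d + 36 * A\<^sup>2 * (K * X)" by (simp add: mult_ac)
  have "p \<le> W * q" using nonneg by (simp add: p q power2_eq_square algebra_simps)
  then have "p\<^sup>2 \<le> (W * q)\<^sup>2" using nonneg by (intro power_mono) auto
  then have p2: "p\<^sup>2 \<le> W\<^sup>2 * q\<^sup>2" by (simp add: power_mult_distrib)
  have KX: "K * (n * t\<^sup>2 * z\<^sup>2) * p\<^sup>2 \<le> K * X"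
  proof -
    have "(n * t\<^sup>2 * z\<^sup>2) * p\<^sup>2 \<le> (n * t\<^sup>2 * z\<^sup>2) * (W\<^sup>2 * q\<^sup>2)"
      using p2 nonneg by (intro mult_left_mono) auto
    also have "\<dots> \<le> X" unfolding X_def using nonneg by (simp add: algebra_simps)
    finally show ?thesis using nonneg by (simp add: mult_left_mono mult.assoc)
  qed
  \<comment> \<open>One bound serves both cases. The quantity \<open>d\<close> has no sign and only
    its integral will be known, so its coefficient must be the same at every point.\<close>
  have "K * n * t ^ 4 * z\<^sup>2 \<le> 5 * (k * n * t ^ 4 * z\<^sup>2) + 4 * (K * (n * t\<^sup>2 * z\<^sup>2) * p\<^sup>2)"
  proof (cases "2 * p \<le> t")
    case True
    have "K * (n * t ^ 4 * z\<^sup>2) \<le> 5 * k * (n * t ^ 4 * z\<^sup>2)"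
      using K(2)[OF True] nonneg by (intro mult_right_mono) auto
    moreover have "0 \<le> K * (n * t\<^sup>2 * z\<^sup>2) * p\<^sup>2" using nonneg by simp
    ultimately show ?thesis by (simp add: mult.assoc)
  next
    case False
    then have "t\<^sup>2 \<le> (2 * p)\<^sup>2" using nonneg by (intro power_mono) auto
    then have "K * (n * t\<^sup>2 * z\<^sup>2) * t\<^sup>2 \<le> K * (n * t\<^sup>2 * z\<^sup>2) * (2 * p)\<^sup>2"
      using nonneg by (intro mult_left_mono) auto
    moreover have "0 \<le> k * n * t ^ 4 * z\<^sup>2" using nonneg by simp
    moreover have "K * n * t ^ 4 * z\<^sup>2 = K * (n * t\<^sup>2 * z\<^sup>2) * t\<^sup>2"
      by (simp add: power2_eq_square power4_eq_xxxx)
    moreover have "K * (n * t\<^sup>2 * z\<^sup>2) * (2 * p)\<^sup>2 = 4 * (K * (n * t\<^sup>2 * z\<^sup>2) * p\<^sup>2)"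
      by (simp add: power_mult_distrib)
    ultimately show ?thesis by linarith
  qed
  \<comment> \<open>The 36 is 12 from Young's inequality times 3 from \<open>k \<le> 3 * K\<close>;
    the factor 5 makes it 180.\<close>
  also have "\<dots> \<le> 5 * (2 * d + 36 * A\<^sup>2 * (K * X)) + 4 * (K * X)"
    using kle KX by (intro add_mono mult_left_mono) auto
  also have "\<dots> = 10 * d + (180 * A\<^sup>2 + 4) * (K * X)" by (simp add: algebra_simps)
  finally show ?thesis by (simp add: X_def)
qed

section \<open>The weighted gradient estimate\<close>

lemma zero_outside_supp: "x \<in> U \<Longrightarrow> x \<notin> supp U f \<Longrightarrow> f x = 0"
  using closure_subset[of "support_on U f"] by (auto simp: supp_def in_support_on)

text \<open>The derivative vanishes as a linear map; it is tested on the gradient itself.\<close>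

lemma gradient_zero_outside_supp:
  assumes "C1_on f U" "open U" "x \<in> U" "x \<notin> supp U f"
  shows "gradient f x = 0"
proof -
  have "(\<lambda>h. gradient f x \<bullet> h) = (\<lambda>_. 0)"
    by (rule has_derivative_outside_support[OF assms(2) _ _
          C1_on_has_derivative_gradient[OF assms(1,3)] assms(3,4)])
      (simp_all add: supp_def zero_outside_supp[unfolded supp_def])
  then have "gradient f x \<bullet> gradient f x = 0" by metis
  then show ?thesis by simp
qed

lemma C2_onD:
  assumes "C2_on w U"
  shows "x \<in> U \<Longrightarrow> (w has_derivative (\<lambda>h. gradient w x \<bullet> h)) (at x)"
    and "x \<in> U \<Longrightarrow> (gradient w has_derivative (\<lambda>h. hessian w x *v h)) (at x)"
    and "continuous_on U w" "continuous_on U (gradient w)" "continuous_on U (hessian w)"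
proof -
  have w: "C1_on w U" "C1_on (gradient w) U" using assms by (auto simp: C2_on_def)
  show "x \<in> U \<Longrightarrow> (w has_derivative (\<lambda>h. gradient w x \<bullet> h)) (at x)"
    using w(1) by (rule C1_on_has_derivative_gradient)
  show "x \<in> U \<Longrightarrow> (gradient w has_derivative (\<lambda>h. hessian w x *v h)) (at x)"
    unfolding hessian_def using w(2) by (rule C1_on_has_derivative_jacobian)
  show "continuous_on U w" "continuous_on U (gradient w)"
    using w by (simp_all add: C1_on_continuous_on)
  show "continuous_on U (hessian w)"
    unfolding hessian_def using w(2) by (rule C1_on_continuous_on_jacobian)
qed

lemma K_nonneg: "K a w Q x \<ge> 0"
  by (simp add: K_def)

text \<open>The base is at least 1, so the power is continuous. Differentiability may fail where the
  vector inside the norm vanishes, hence the smooth weight \<open>k\<close> below.\<close>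

lemma continuous_on_K:
  assumes "C1_on Q U" "C2_on w U"
  shows "continuous_on U (K a w Q)"
proof -
  have "1 + norm y \<noteq> 0" for y :: "real ^ 3"
    using norm_ge_zero[of y] by linarith
  then show ?thesis
    unfolding K_def
    by (intro continuous_intros C1_on_continuous_on[OF assms(1)] C2_onD(3,4)[OF assms(2)]) auto
qed

text \<open>The pointwise bound is integrated and the divergence drops out. All integrands are
  continuous on \<open>U\<close> and vanish off the support of the cut-off. The constant involves
  only \<open>a\<close> and \<open>s\<close>.\<close>

lemma weighted_gradient_estimate:
  fixes Q :: "real ^ 3 \<Rightarrow> real ^ 3" and w \<zeta> :: "real ^ 3 \<Rightarrow> real" and a s :: real
  assumes a: "0 \<le> a" "a \<le> 1" and s: "s \<ge> 1" and U: "open U"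
    and reg: "C1_on Q U" "C2_on w U" "C1c_on \<zeta> U"
  defines "L \<equiv> \<lambda>x. K a w Q x * norm (gradient w x) powr (2 * s + 2) * (\<zeta> x)\<^sup>2"
    and "R \<equiv> \<lambda>x. K a w Q x * (w x)\<^sup>2 *
        ((norm (hessian w x))\<^sup>2 * norm (gradient w x) powr0 (2 * s - 2) * (\<zeta> x)\<^sup>2
         + norm (gradient w x) powr (2 * s) * ((norm (gradient \<zeta> x))\<^sup>2
           + (\<bar>w x\<bar> * norm (jacobian Q (at x)) + norm (Q x))\<^sup>2 * (\<zeta> x)\<^sup>2 * (w x)\<^sup>2))"
  shows "set_integrable lborel U L" and "set_integrable lborel U R"
    and "(LINT x:U|lborel. L x) \<le> (180 * (a + 2 * s + 3)\<^sup>2 + 4) * (LINT x:U|lborel. R x)"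
proof -
  \<comment> \<open>The coefficients of the Hessian norm: \<open>a\<close> from differentiating
    \<open>k\<close>, \<open>2 * s\<close> from differentiating \<open>N\<close>, 3 from the
    trace.\<close>
  define A where "A = a + 2 * s + 3"
  define v where "v = gradient w"
  define H where "H = hessian w"
  define Q' where "Q' x = jacobian Q (at x)" for x
  define Z where "Z = gradient \<zeta>"
  define P where "P x = (w x)\<^sup>2 *\<^sub>R Q x" for x
  define P' where "P' x h = (w x)\<^sup>2 *\<^sub>R (Q' x *v h) + (2 * w x * (v x \<bullet> h)) *\<^sub>R Q x" for x h
  define D where "D x = 1 + v x \<bullet> v x + P x \<bullet> P x" for x
  define k where "k x = D x powr (- a / 2)" for x
  define k' where "k' x h = - (a / D x * k x * (v x \<bullet> (H x *v h) + P x \<bullet> P' x h))" for x h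
  define n where "n x = norm (v x) powr0 (2 * s - 2)" for x
  define N where "N x = norm (v x) powr (2 * s)" for x
  define N' where "N' x h = 2 * s * n x * (v x \<bullet> (H x *v h))" for x h
  \<comment> \<open>The scalar factor of the test field \<open>g\<close> times
    \<open>v\<close>.\<close>
  define g where "g x = w x * (k x * N x * (\<zeta> x)\<^sup>2)" for x
  define g' where "g' x h = (v x \<bullet> h) * (k x * N x * (\<zeta> x)\<^sup>2)
    + w x * (k' x h * N x * (\<zeta> x)\<^sup>2 + k x * N' x h * (\<zeta> x)\<^sup>2 + k x * N x * (2 * \<zeta> x * (Z x \<bullet> h)))" for x h
  note defs = v_def H_def Q'_def Z_def
  have \<zeta>: "C1_on \<zeta> U" and S: "compact (supp U \<zeta>)" "supp U \<zeta> \<subseteq> U"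
    using reg(3) by (auto simp: C1c_on_def)
  have D_pos: "D x > 0" for x
    by (simp add: D_def add_pos_nonneg)
  have der_w: "(w has_derivative (\<lambda>h. v x \<bullet> h)) (at x)"
    and der_v: "(v has_derivative (\<lambda>h. H x *v h)) (at x)"
    and der_Q: "(Q has_derivative (\<lambda>h. Q' x *v h)) (at x)"
    and der_\<zeta>: "(\<zeta> has_derivative (\<lambda>h. Z x \<bullet> h)) (at x)" if "x \<in> U" for x
    unfolding defs using that reg(1) \<zeta> C2_onD(1,2)[OF reg(2)]
    by (simp_all add: C1_on_has_derivative_jacobian C1_on_has_derivative_gradient)
  have cont: "continuous_on U w" "continuous_on U v" "continuous_on U H"
    "continuous_on U Q" "continuous_on U Q'" "continuous_on U \<zeta>" "continuous_on U Z"
    unfolding defs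
    using C2_onD(3-5)[OF reg(2)] reg(1) \<zeta>
    by (auto simp: C1_on_continuous_on C1_on_continuous_on_jacobian C1_on_continuous_on_gradient)
  have cont_P: "continuous_on U P" "continuous_on U (\<lambda>x. P' x h)" for h
    unfolding P_def P'_def by (intro continuous_intros cont)+
  have cont_D: "continuous_on U D"
    unfolding D_def by (intro continuous_intros cont cont_P)
  have cont_k: "continuous_on U k"
    unfolding k_def using D_pos by (intro continuous_intros cont_D) (simp add: less_imp_neq[symmetric])
  have cont_k': "continuous_on U (\<lambda>x. k' x h)" for h
    unfolding k'_def using D_pos
    by (intro continuous_intros cont cont_P cont_D cont_k) (simp add: less_imp_neq[symmetric])
  have cont_n: "continuous_on U n"
    unfolding n_def using s by (intro continuous_intros cont) auto
  have cont_N: "continuous_on U N"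
    unfolding N_def using s by (intro continuous_on_powr' continuous_intros cont) auto
  have cont_g': "continuous_on U (\<lambda>x. g' x h)" for h
    unfolding g'_def N'_def by (intro continuous_intros cont cont_k cont_k' cont_n cont_N)
  have der_P: "(P has_derivative P' x) (at x)" if "x \<in> U" for x
    unfolding P_def P'_def
    by (rule has_derivative_eq_rhs, (rule derivative_intros der_w der_Q that)+)
      (simp add: fun_eq_iff mult_ac)
  have der_k: "(k has_derivative k' x) (at x)" if "x \<in> U" for x
  proof -
    have "(D has_derivative (\<lambda>h. 2 * (v x \<bullet> (H x *v h) + P x \<bullet> P' x h))) (at x)"
      unfolding D_def
      by (rule has_derivative_eq_rhs, (rule derivative_intros der_v der_P that)+)
        (simp add: fun_eq_iff inner_commute)
    from has_derivative_powr[OF this has_derivative_const[of "- a / 2"] D_pos]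
    have "(k has_derivative (\<lambda>h. D x powr (- a / 2) *
        (0 * ln (D x) + 2 * (v x \<bullet> (H x *v h) + P x \<bullet> P' x h) * (- a / 2) / D x))) (at x)"
      unfolding k_def by simp
    then show ?thesis
      by (rule has_derivative_eq_rhs) (use D_pos[of x] in \<open>simp add: fun_eq_iff k'_def k_def field_simps\<close>)
  qed
  have der_N: "(N has_derivative N' x) (at x)" if "x \<in> U" for x
  proof -
    have "((\<lambda>x. norm (v x) powr (2 * s)) has_derivative
        (\<lambda>h. 2 * s * norm (v x) powr0 (2 * s - 2) * (v x \<bullet> (H x *v h)))) (at x)"
      using has_derivative_compose[OF der_v[OF that] has_derivative_norm_powr[of "2 * s" "v x"]] s
      by simp
    then show ?thesis by (simp add: N_def[abs_def] N'_def[abs_def] n_def)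
  qed
  have der_g: "(g has_derivative g' x) (at x)" if "x \<in> U" for x
    unfolding g_def g'_def
    by (rule has_derivative_eq_rhs, (rule derivative_intros der_w der_k der_N der_\<zeta> that)+)
      (simp add: fun_eq_iff power2_eq_square algebra_simps)
  have g_zero: "g x = 0" if "x \<in> U" "x \<notin> supp U \<zeta>" for x
    using zero_outside_supp[OF that] by (simp add: g_def)
  \<comment> \<open>The divergence of the test field, since \<open>H\<close> is the Jacobian of
    \<open>v\<close>.\<close>
  define d where "d x = g' x (v x) + g x * trace (H x)" for x
  have d: "set_integrable lborel U d" "(LINT x:U|lborel. d x) = 0"
    unfolding d_def
    using set_integral_divergence_eq_0[OF U S der_g cont_g' der_v cont(3) g_zero] by blast+
  have bound: "L x \<le> 10 * d x + (180 * A\<^sup>2 + 4) * R x" if x: "x \<in> U" for x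
  proof -
    define t where "t = norm (v x)"
    define W where "W = \<bar>w x\<bar>"
    define p where "p = W\<^sup>2 * norm (Q x)"
    define q where "q = W * (W * norm (Q' x) + norm (Q x))"
    define z where "z = \<bar>\<zeta> x\<bar>"
    \<comment> \<open>All of \<open>d x\<close> except the term in which \<open>w\<close> is
      differentiated; that term is \<open>k x * n x * t ^ 4 * z\<^sup>2\<close>, the quantity to be
      bounded.\<close>
    define E where "E = w x * (k' x (v x) * N x * (\<zeta> x)\<^sup>2 + k x * N' x (v x) * (\<zeta> x)\<^sup>2
        + k x * N x * (2 * \<zeta> x * (Z x \<bullet> v x))) + g x * trace (H x)"
    have nonneg: "0 \<le> t" "0 \<le> W" "0 \<le> p" "0 \<le> q" "0 \<le> z" "0 \<le> k x" "0 \<le> n x"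
      by (auto simp: t_def W_def p_def q_def z_def k_def n_def powr0_nonneg)
    have sq: "z\<^sup>2 = (\<zeta> x)\<^sup>2" "W\<^sup>2 = (w x)\<^sup>2" by (auto simp: z_def W_def)
    have p: "norm (P x) = p" by (simp add: P_def p_def sq)
    have D: "D x = 1 + t\<^sup>2 + p\<^sup>2"
      by (simp add: D_def t_def power2_norm_eq_inner flip: p)
    have N: "N x = n x * t\<^sup>2"
      using powr0_mult_power2[of t "2 * s"] nonneg s by (simp add: N_def n_def t_def)
    have Nt: "norm (v x) powr (2 * s + 2) = n x * t ^ 4"
      using powr0_mult_power4[of t "2 * s"] nonneg s by (simp add: n_def t_def)
    have vHv: "\<bar>v x \<bullet> (H x *v v x)\<bar> \<le> t\<^sup>2 * norm (H x)"
    proof -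
      have "\<bar>v x \<bullet> (H x *v v x)\<bar> \<le> t * norm (H x *v v x)"
        unfolding t_def by (rule Cauchy_Schwarz_ineq2)
      also have "\<dots> \<le> t * (norm (H x) * t)"
        unfolding t_def by (intro mult_left_mono norm_matrix_vector_mult_le) simp
      finally show ?thesis by (simp add: power2_eq_square mult_ac)
    qed
    have PPv: "\<bar>P x \<bullet> P' x (v x)\<bar> \<le> p * (W\<^sup>2 * (norm (Q' x) * t) + 2 * W * t\<^sup>2 * norm (Q x))"
    proof -
      have "\<bar>P x \<bullet> P' x (v x)\<bar> \<le> p * norm (P' x (v x))"
        unfolding p[symmetric] by (rule Cauchy_Schwarz_ineq2)
      also have "norm (P' x (v x)) \<le> W\<^sup>2 * norm (Q' x *v v x) + 2 * W * t\<^sup>2 * norm (Q x)"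
        unfolding P'_def
        by (rule norm_triangle_le) (simp add: sq abs_mult W_def t_def power2_norm_eq_inner)
      also have "\<dots> \<le> W\<^sup>2 * (norm (Q' x) * t) + 2 * W * t\<^sup>2 * norm (Q x)"
        unfolding t_def by (intro add_right_mono mult_left_mono norm_matrix_vector_mult_le) simp
      finally show ?thesis using nonneg by (simp add: mult_left_mono)
    qed
    \<comment> \<open>These bounds cancel the factor \<open>1 / D x\<close> in \<open>k'\<close>, so
      differentiating the weight costs no further power of \<open>t\<close> or
      \<open>p\<close>.\<close>
    have Dle: "t\<^sup>2 \<le> D x" "p \<le> D x" "p * t \<le> D x"
    proof -
      show "t\<^sup>2 \<le> D x" by (simp add: D)
      have "2 * p \<le> 1 + p\<^sup>2" "2 * (p * t) \<le> t\<^sup>2 + p\<^sup>2"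
        using zero_le_power2[of "1 - p"] zero_le_power2[of "t - p"]
        by (simp_all add: power2_eq_square algebra_simps)
      then show "p \<le> D x" "p * t \<le> D x"
        unfolding D using nonneg zero_le_power2[of t] zero_le_power2[of p] by linarith+
    qed
    have k'v: "\<bar>k' x (v x)\<bar> \<le> a * k x * (norm (H x) + 2 * t * q)"
    proof -
      have "\<bar>v x \<bullet> (H x *v v x) + P x \<bullet> P' x (v x)\<bar>
          \<le> t\<^sup>2 * norm (H x) + (p * (W\<^sup>2 * (norm (Q' x) * t)) + p * t * (2 * W * t * norm (Q x)))"
        using vHv PPv by (simp add: power2_eq_square algebra_simps)
      also have "\<dots> \<le> D x * norm (H x) + (D x * (W\<^sup>2 * (norm (Q' x) * t)) + D x * (2 * W * t * norm (Q x)))"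
        using nonneg by (intro add_mono mult_right_mono Dle) auto
      also have "\<dots> \<le> D x * (norm (H x) + 2 * t * q)"
      proof -
        have "0 \<le> D x * (W\<^sup>2 * (norm (Q' x) * t))"
          using nonneg D_pos[of x] by simp
        then show ?thesis by (simp add: q_def power2_eq_square algebra_simps)
      qed
      finally have *: "\<bar>v x \<bullet> (H x *v v x) + P x \<bullet> P' x (v x)\<bar> \<le> D x * (norm (H x) + 2 * t * q)" .
      have "\<bar>k' x (v x)\<bar> = a / D x * k x * \<bar>v x \<bullet> (H x *v v x) + P x \<bullet> P' x (v x)\<bar>"
        using a nonneg D_pos[of x] by (simp add: k'_def abs_mult)
      also have "\<dots> \<le> a / D x * k x * (D x * (norm (H x) + 2 * t * q))"
        using * a nonneg D_pos[of x] by (intro mult_left_mono) auto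
      finally show ?thesis using D_pos[of x] by simp
    qed
    have N'v: "\<bar>N' x (v x)\<bar> \<le> 2 * s * n x * (t\<^sup>2 * norm (H x))"
      using vHv s nonneg by (simp add: N'_def abs_mult mult_left_mono)
    have Zv: "\<bar>Z x \<bullet> v x\<bar> \<le> norm (Z x) * t"
      unfolding t_def by (rule Cauchy_Schwarz_ineq2)
    have tr: "\<bar>trace (H x)\<bar> \<le> 3 * norm (H x)"
      using abs_trace_le[of "H x"] by simp
    have E: "\<bar>E\<bar> \<le> k x * n x * t\<^sup>2 * (W * z\<^sup>2 * (A * norm (H x) + 2 * a * t * q)
        + 2 * W * z * t * norm (Z x))"
    proof -
      have "\<bar>E\<bar> \<le> W * (\<bar>k' x (v x)\<bar> * (n x * t\<^sup>2) * z\<^sup>2 + k x * \<bar>N' x (v x)\<bar> * z\<^sup>2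
          + k x * (n x * t\<^sup>2) * (2 * z * \<bar>Z x \<bullet> v x\<bar>)) + W * (k x * (n x * t\<^sup>2) * z\<^sup>2) * \<bar>trace (H x)\<bar>"
      proof -
        have tri: "\<bar>b * (c1 + c2 + c3) + e\<bar> \<le> \<bar>b\<bar> * (\<bar>c1\<bar> + \<bar>c2\<bar> + \<bar>c3\<bar>) + \<bar>e\<bar>" for b c1 c2 c3 e :: real
        proof -
          have "\<bar>b * (c1 + c2 + c3)\<bar> \<le> \<bar>b\<bar> * (\<bar>c1\<bar> + \<bar>c2\<bar> + \<bar>c3\<bar>)"
            unfolding abs_mult by (intro mult_left_mono) auto
          then show ?thesis by linarith
        qed
        show ?thesis
          unfolding E_def g_def N
          by (rule order_trans[OF tri])
            (use nonneg in \<open>simp add: abs_mult W_def z_def\<close>)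
      qed
      also have "\<dots> \<le> W * (a * k x * (norm (H x) + 2 * t * q) * (n x * t\<^sup>2) * z\<^sup>2
          + k x * (2 * s * n x * (t\<^sup>2 * norm (H x))) * z\<^sup>2
          + k x * (n x * t\<^sup>2) * (2 * z * (norm (Z x) * t)))
          + W * (k x * (n x * t\<^sup>2) * z\<^sup>2) * (3 * norm (H x))"
        using nonneg by (intro add_mono mult_left_mono mult_right_mono k'v N'v Zv tr) auto
      also have "\<dots> = k x * n x * t\<^sup>2 * (W * z\<^sup>2 * (A * norm (H x) + 2 * a * t * q)
        + 2 * W * z * t * norm (Z x))"
        by (simp add: A_def algebra_simps)
      finally show ?thesis .
    qed
    have "d x = k x * n x * t ^ 4 * z\<^sup>2 + E"
      unfolding d_def g'_def E_def N sq power2_norm_eq_inner[symmetric] t_def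
      by (simp add: power2_eq_square power4_eq_xxxx algebra_simps)
    with E have le: "k x * n x * t ^ 4 * z\<^sup>2 \<le> d x + k x * n x * t\<^sup>2 *
        (W * z\<^sup>2 * (A * norm (H x) + 2 * a * t * q) + 2 * W * z * t * norm (Z x))"
      by linarith
    define r where "r = norm (v x + P x)"
    have r: "0 \<le> r" "r \<le> t + p" "t \<le> r + p"
      using norm_triangle_ineq[of "v x" "P x"] norm_triangle_ineq4[of "v x + P x" "P x"]
      by (auto simp: r_def t_def p)
    have K: "K a w Q x = (1 + r) powr - a"
      by (simp add: K_def r_def v_def P_def)
    have "K a w Q x * n x * t ^ 4 * z\<^sup>2 \<le> 10 * d x + (180 * A\<^sup>2 + 4) *
        (K a w Q x * (W\<^sup>2 * n x * ((norm (H x))\<^sup>2 * z\<^sup>2 + t\<^sup>2 * (q\<^sup>2 * z\<^sup>2 + (norm (Z x))\<^sup>2))))"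
    proof (rule pointwise_gradient_bound[OF nonneg(6) K_nonneg nonneg(7,1,3,2) norm_ge_zero norm_ge_zero _ _ _ q_def p_def _ _ le])
      show "k x \<le> 3 * K a w Q x" "2 * p \<le> t \<Longrightarrow> K a w Q x \<le> 5 * k x"
        unfolding K k_def D using smooth_weight_compare[OF a nonneg(1,3) r] by auto
    qed (use a s in \<open>auto simp: A_def\<close>)
    moreover have "K a w Q x * n x * t ^ 4 * z\<^sup>2 = L x"
      using Nt by (simp add: sq v_def L_def)
    moreover have "K a w Q x * (W\<^sup>2 * n x * ((norm (H x))\<^sup>2 * z\<^sup>2 + t\<^sup>2 * (q\<^sup>2 * z\<^sup>2 + (norm (Z x))\<^sup>2))) = R x"
    proof -
      have "q\<^sup>2 = (w x)\<^sup>2 * (\<bar>w x\<bar> * norm (Q' x) + norm (Q x))\<^sup>2"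
        by (simp add: q_def W_def power_mult_distrib)
      then show ?thesis
        using N unfolding N_def sq by (simp add: R_def n_def t_def defs algebra_simps)
    qed
    ultimately show ?thesis by simp
  qed
  have cont_K: "continuous_on U (K a w Q)"
    using reg(1,2) by (rule continuous_on_K)
  show L: "set_integrable lborel U L"
  proof (rule set_integrable_compact_support[OF S])
    have "continuous_on U (\<lambda>x. norm (v x) powr (2 * s + 2))"
      using s by (intro continuous_on_powr' continuous_intros cont) auto
    then show "continuous_on U L"
      unfolding L_def defs[symmetric]
      by (intro continuous_on_mult continuous_on_power cont cont_K)
  qed (simp add: L_def zero_outside_supp)
  show R: "set_integrable lborel U R"
  proof (rule set_integrable_compact_support[OF S])
    show "continuous_on U R"
      unfolding R_def defs[symmetric] N_def[symmetric] n_def[symmetric]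
      by (intro continuous_intros cont cont_K cont_n cont_N)
  qed (simp add: R_def zero_outside_supp gradient_zero_outside_supp[OF \<zeta> U])
  \<comment> \<open>The integral of \<open>d\<close> is 0, so its coefficient 10 leaves no
    trace.\<close>
  have "(LINT x:U|lborel. L x) \<le> (LINT x:U|lborel. 10 * d x + (180 * A\<^sup>2 + 4) * R x)"
    by (intro set_integral_mono L bound set_integral_add(1) set_integrable_mult_right d R)
  also have "\<dots> = 10 * (LINT x:U|lborel. d x) + (180 * A\<^sup>2 + 4) * (LINT x:U|lborel. R x)"
    by (subst set_integral_add(2)) (auto intro: d R)
  finally show "(LINT x:U|lborel. L x) \<le> (180 * (a + 2 * s + 3)\<^sup>2 + 4) * (LINT x:U|lborel. R x)"
    by (simp add: d A_def)
qed

section \<open>Deduction of the two inequalities by taking suprema over the support and over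
  \<open>U\<close>\<close>

theorem theorem4p2:
  fixes \<alpha>\<^sub>N a s :: real
  assumes "\<alpha>\<^sub>N > 0" and "a = \<alpha>\<^sub>N / (1 + \<alpha>\<^sub>N)" and "s \<ge> 1"
  shows "\<exists>C>0. \<forall>(U :: (real ^ 3) set) (Q :: real ^ 3 \<Rightarrow> real ^ 3) (w :: real ^ 3 \<Rightarrow> real)
             (\<zeta> :: real ^ 3 \<Rightarrow> real).
    open U \<and> bounded U \<and> C1_boundary U \<and> C1_on Q U \<and> C2_on w U \<and>
    C1c_on \<zeta> U \<and> (\<forall>x\<in>U. \<zeta> x \<ge> 0) \<longrightarrow>
    (LINT x:U|lborel. K a w Q x * norm (gradient w x) powr (2 * s + 2) * (\<zeta> x)\<^sup>2)
      \<le> C * (SUP x\<in>supp U \<zeta>. (w x)\<^sup>2) *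
          ((LINT x:U|lborel. K a w Q x * (norm (hessian w x))\<^sup>2
              * (norm (gradient w x) powr0 (2 * s - 2) + 1) * (\<zeta> x)\<^sup>2)
           + (LINT x:U|lborel. K a w Q x * norm (gradient w x) powr (2 * s)
              * ((norm (gradient \<zeta> x))\<^sup>2
                 + (\<bar>w x\<bar> * norm (jacobian Q (at x)) + norm (Q x))\<^sup>2 * (\<zeta> x)\<^sup>2 * (w x)\<^sup>2)))
        + C * (LINT x:U|lborel. (1 + norm ((w x)\<^sup>2 *\<^sub>R Q x) powr (2 * s))
              * norm ((w x)\<^sup>2 *\<^sub>R Q x) powr (2 * s + 2) * (\<zeta> x)\<^sup>2)
    \<and>
    (bounded (Q ` U) \<and> bounded ((\<lambda>x. jacobian Q (at x)) ` U) \<longrightarrow>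
      (let M\<^sub>w = (SUP x\<in>supp U \<zeta>. \<bar>w x\<bar>);
           M\<^sub>Q = (SUP x\<in>U. norm (Q x));
           \<mu>\<^sub>Q = (SUP x\<in>U. norm (jacobian Q (at x)))
       in
       (LINT x:U|lborel. K a w Q x * norm (gradient w x) powr (2 * s + 2) * (\<zeta> x)\<^sup>2)
         \<le> C * M\<^sub>w\<^sup>2 * (LINT x:U|lborel. K a w Q x * (norm (hessian w x))\<^sup>2
                 * norm (gradient w x) powr0 (2 * s - 2) * (\<zeta> x)\<^sup>2)
           + C * M\<^sub>w\<^sup>2 * (LINT x:U|lborel. K a w Q x * norm (gradient w x) powr (2 * s)
                 * ((norm (gradient \<zeta> x))\<^sup>2 + (M\<^sub>w * \<mu>\<^sub>Q + M\<^sub>Q)\<^sup>2 * M\<^sub>w\<^sup>2 * (\<zeta> x)\<^sup>2))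
           + C * sgn (s - 1) * M\<^sub>w\<^sup>2 * (LINT x:U|lborel. K a w Q x * (norm (hessian w x))\<^sup>2 * (\<zeta> x)\<^sup>2)
           + C * measure lborel U * (M\<^sub>w\<^sup>2 * M\<^sub>Q) powr (2 * s + 2) * (1 + M\<^sub>w\<^sup>2 * M\<^sub>Q) powr (2 * s)))"
proof (intro exI[of _ "180 * (a + 2 * s + 3)\<^sup>2 + 4"] conjI allI impI)
  let ?C = "180 * (a + 2 * s + 3)\<^sup>2 + 4"
  show "?C > 0" by (simp add: add_nonneg_pos)
  fix U :: "(real ^ 3) set" and Q :: "real ^ 3 \<Rightarrow> real ^ 3" and w \<zeta> :: "real ^ 3 \<Rightarrow> real"
  assume hyps: "open U \<and> bounded U \<and> C1_boundary U \<and> C1_on Q U \<and> C2_on w U \<and>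
    C1c_on \<zeta> U \<and> (\<forall>x\<in>U. \<zeta> x \<ge> 0)"
  then have U: "open U" and reg: "C1_on Q U" "C2_on w U" "C1c_on \<zeta> U" by auto
  have \<zeta>: "C1_on \<zeta> U" and S: "compact (supp U \<zeta>)" "supp U \<zeta> \<subseteq> U"
    using reg(3) by (auto simp: C1c_on_def)
  have a: "0 \<le> a" "a \<le> 1" using assms(1) by (simp_all add: assms(2) divide_le_eq)
  have C: "?C \<ge> 0" by simp
  define L where "L x = K a w Q x * norm (gradient w x) powr (2 * s + 2) * (\<zeta> x)\<^sup>2" for x
  define R where "R x = K a w Q x * (w x)\<^sup>2 *
      ((norm (hessian w x))\<^sup>2 * norm (gradient w x) powr0 (2 * s - 2) * (\<zeta> x)\<^sup>2
       + norm (gradient w x) powr (2 * s) * ((norm (gradient \<zeta> x))\<^sup>2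
         + (\<bar>w x\<bar> * norm (jacobian Q (at x)) + norm (Q x))\<^sup>2 * (\<zeta> x)\<^sup>2 * (w x)\<^sup>2))" for x
  have main: "set_integrable lborel U R" "(LINT x:U|lborel. L x) \<le> ?C * (LINT x:U|lborel. R x)"
    using weighted_gradient_estimate(2,3)[OF a assms(3) U reg]
    by (simp_all add: L_def[abs_def] R_def[abs_def])
  have cont: "continuous_on U w" "continuous_on U (hessian w)" "continuous_on U Q"
    "continuous_on U (\<lambda>x. jacobian Q (at x))" "continuous_on U \<zeta>" "continuous_on U (gradient \<zeta>)"
    "continuous_on U (K a w Q)"
    using C2_onD(3-5)[OF reg(2)] reg \<zeta>
    by (auto simp: C1_on_continuous_on C1_on_continuous_on_jacobian C1_on_continuous_on_gradient continuous_on_K)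
  have cont_t: "continuous_on U (\<lambda>x. norm (gradient w x) powr0 (2 * s - 2))"
    "continuous_on U (\<lambda>x. norm (gradient w x) powr (2 * s))"
    using assms(3)
    by (auto intro!: continuous_intros continuous_on_powr' C2_onD(4)[OF reg(2)])
  have outside: "\<zeta> x = 0" "gradient \<zeta> x = 0" if "x \<in> U" "x \<notin> supp U \<zeta>" for x
    using that zero_outside_supp gradient_zero_outside_supp[OF \<zeta> U] by auto
  \<comment> \<open>Common to both inequalities: it remains to bound \<open>R\<close> pointwise,
    with \<open>B\<close> a supremum of the squared values of \<open>w\<close> or the square of a
    supremum.\<close>
  have R_bound: "(LINT x:U|lborel. L x) \<le> ?C * B * ((LINT x:U|lborel. F x) + (LINT x:U|lborel. G x))"
    if F: "set_integrable lborel U F" and G: "set_integrable lborel U G"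
      and le: "\<And>x. x \<in> U \<Longrightarrow> R x \<le> B * (F x + G x)" for F G :: "real ^ 3 \<Rightarrow> real" and B :: real
  proof -
    have "(LINT x:U|lborel. R x) \<le> (LINT x:U|lborel. B * (F x + G x))"
      by (intro set_integral_mono main(1) set_integrable_mult_right set_integral_add(1) F G le)
    also have "\<dots> = B * ((LINT x:U|lborel. F x) + (LINT x:U|lborel. G x))"
      by (simp add: set_integral_add(2)[OF F G])
    finally have "?C * (LINT x:U|lborel. R x) \<le> ?C * (B * ((LINT x:U|lborel. F x) + (LINT x:U|lborel. G x)))"
      using C by (rule mult_left_mono)
    with main(2) show ?thesis by (simp only: mult.assoc)
  qed
  \<comment> \<open>A function that is not integrable has integral 0 by default, so the sign of
    \<open>f\<close> decides.\<close>
  have nonneg: "0 \<le> (LINT x:U|lborel. f x)" if "\<And>x. f x \<ge> 0" for f :: "real ^ 3 \<Rightarrow> real"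
    unfolding set_lebesgue_integral_def using that by (intro integral_nonneg_AE) auto
  have bdd: "bdd_above ((\<lambda>x. (w x)\<^sup>2) ` supp U \<zeta>)" "bdd_above ((\<lambda>x. \<bar>w x\<bar>) ` supp U \<zeta>)"
    using S(2) by (intro bounded_imp_bdd_above compact_imp_bounded compact_continuous_image
        continuous_intros continuous_on_subset[OF cont(1)] S(1); simp)+
  let ?n = "\<lambda>x. norm (gradient w x) powr0 (2 * s - 2)"
  let ?N = "\<lambda>x. norm (gradient w x) powr (2 * s)"
  let ?H = "\<lambda>x. (norm (hessian w x))\<^sup>2"
  let ?q = "\<lambda>x. \<bar>w x\<bar> * norm (jacobian Q (at x)) + norm (Q x)"
  {
    define F where "F x = K a w Q x * ?H x * (?n x + 1) * (\<zeta> x)\<^sup>2" for x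
    define G where "G x = K a w Q x * ?N x
      * ((norm (gradient \<zeta> x))\<^sup>2 + (?q x)\<^sup>2 * (\<zeta> x)\<^sup>2 * (w x)\<^sup>2)" for x
    define B where "B = (SUP x\<in>supp U \<zeta>. (w x)\<^sup>2)"
    have "set_integrable lborel U F" "set_integrable lborel U G"
      unfolding F_def G_def
      by (intro set_integrable_compact_support[OF S] continuous_intros cont cont_t; simp add: outside)+
    \<comment> \<open>Off the support \<open>R\<close>, \<open>F\<close> and \<open>G\<close> are
      all 0. This also covers an empty support, where \<open>B\<close> is a supremum over the empty
      set.\<close>
    moreover have "R x \<le> B * (F x + G x)" if x: "x \<in> U" for x
    proof (cases "x \<in> supp U \<zeta>")
      case True
      have FG: "0 \<le> F x + G x"
        unfolding F_def G_def by (intro add_nonneg_nonneg mult_nonneg_nonneg K_nonneg powr0_nonneg) auto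
      \<comment> \<open>The contribution of the summand 1 in \<open>F\<close>, which enlarges the
        right-hand side.\<close>
      have "0 \<le> K a w Q x * ?H x * (\<zeta> x)\<^sup>2" using K_nonneg by simp
      then have "K a w Q x * (?H x * ?n x * (\<zeta> x)\<^sup>2 + ?N x * ((norm (gradient \<zeta> x))\<^sup>2
          + (?q x)\<^sup>2 * (\<zeta> x)\<^sup>2 * (w x)\<^sup>2)) \<le> F x + G x"
        by (simp add: F_def G_def algebra_simps)
      from mult_left_mono[OF this, of "(w x)\<^sup>2"]
      have "R x \<le> (w x)\<^sup>2 * (F x + G x)" by (simp add: R_def mult_ac)
      also have "\<dots> \<le> B * (F x + G x)"
        using cSUP_upper[OF True bdd(1)] FG unfolding B_def by (rule mult_right_mono)
      finally show ?thesis .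
    qed (use x in \<open>simp add: R_def F_def G_def outside\<close>)
    ultimately have "(LINT x:U|lborel. L x) \<le> ?C * B * ((LINT x:U|lborel. F x) + (LINT x:U|lborel. G x))"
      by (rule R_bound)
    moreover have "0 \<le> ?C * (LINT x:U|lborel. (1 + norm ((w x)\<^sup>2 *\<^sub>R Q x) powr (2 * s))
        * norm ((w x)\<^sup>2 *\<^sub>R Q x) powr (2 * s + 2) * (\<zeta> x)\<^sup>2)"
      using C by (intro mult_nonneg_nonneg nonneg) auto
    ultimately show "(LINT x:U|lborel. K a w Q x * norm (gradient w x) powr (2 * s + 2) * (\<zeta> x)\<^sup>2)
      \<le> ?C * (SUP x\<in>supp U \<zeta>. (w x)\<^sup>2) *
          ((LINT x:U|lborel. K a w Q x * (norm (hessian w x))\<^sup>2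
              * (norm (gradient w x) powr0 (2 * s - 2) + 1) * (\<zeta> x)\<^sup>2)
           + (LINT x:U|lborel. K a w Q x * norm (gradient w x) powr (2 * s)
              * ((norm (gradient \<zeta> x))\<^sup>2
                 + (\<bar>w x\<bar> * norm (jacobian Q (at x)) + norm (Q x))\<^sup>2 * (\<zeta> x)\<^sup>2 * (w x)\<^sup>2)))
        + ?C * (LINT x:U|lborel. (1 + norm ((w x)\<^sup>2 *\<^sub>R Q x) powr (2 * s))
              * norm ((w x)\<^sup>2 *\<^sub>R Q x) powr (2 * s + 2) * (\<zeta> x)\<^sup>2)"
      unfolding L_def F_def G_def B_def by linarith
  }
  assume bounded: "bounded (Q ` U) \<and> bounded ((\<lambda>x. jacobian Q (at x)) ` U)"
  define M\<^sub>w where "M\<^sub>w = (SUP x\<in>supp U \<zeta>. \<bar>w x\<bar>)"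
  define M\<^sub>Q where "M\<^sub>Q = (SUP x\<in>U. norm (Q x))"
  define \<mu>\<^sub>Q where "\<mu>\<^sub>Q = (SUP x\<in>U. norm (jacobian Q (at x)))"
  have w_le: "\<bar>w x\<bar> \<le> M\<^sub>w" if "x \<in> supp U \<zeta>" for x
    unfolding M\<^sub>w_def by (rule cSUP_upper[OF that bdd(2)])
  have Q_le: "norm (Q x) \<le> M\<^sub>Q" "norm (jacobian Q (at x)) \<le> \<mu>\<^sub>Q" if "x \<in> U" for x
  proof -
    \<comment> \<open>Boundedness makes the two suprema genuine upper bounds.\<close>
    have "bdd_above ((\<lambda>x. norm (Q x)) ` U)" "bdd_above ((\<lambda>x. norm (jacobian Q (at x))) ` U)"
      using bounded by (auto simp: bounded_iff bdd_above_def)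
    then show "norm (Q x) \<le> M\<^sub>Q" "norm (jacobian Q (at x)) \<le> \<mu>\<^sub>Q"
      unfolding M\<^sub>Q_def \<mu>\<^sub>Q_def using that by (auto intro: cSUP_upper)
  qed
  define F where "F x = K a w Q x * ?H x * ?n x * (\<zeta> x)\<^sup>2" for x
  define G where "G x = K a w Q x * ?N x
    * ((norm (gradient \<zeta> x))\<^sup>2 + (M\<^sub>w * \<mu>\<^sub>Q + M\<^sub>Q)\<^sup>2 * M\<^sub>w\<^sup>2 * (\<zeta> x)\<^sup>2)" for x
  have "set_integrable lborel U F" "set_integrable lborel U G"
    unfolding F_def G_def
    by (intro set_integrable_compact_support[OF S] continuous_intros cont cont_t; simp add: outside)+
  moreover have "R x \<le> M\<^sub>w\<^sup>2 * (F x + G x)" if x: "x \<in> U" for x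
  proof (cases "x \<in> supp U \<zeta>")
    case True
    have w2: "(w x)\<^sup>2 \<le> M\<^sub>w\<^sup>2"
      using power_mono[OF w_le[OF True], of 2] by simp
    have "?q x \<le> M\<^sub>w * \<mu>\<^sub>Q + M\<^sub>Q"
      using w_le[OF True] Q_le[OF x] by (intro add_mono mult_mono) auto
    then have "(?q x)\<^sup>2 \<le> (M\<^sub>w * \<mu>\<^sub>Q + M\<^sub>Q)\<^sup>2" by (intro power_mono) auto
    with w2 have "(?q x)\<^sup>2 * (w x)\<^sup>2 \<le> (M\<^sub>w * \<mu>\<^sub>Q + M\<^sub>Q)\<^sup>2 * M\<^sub>w\<^sup>2" by (intro mult_mono) auto
    from mult_right_mono[OF this, of "(\<zeta> x)\<^sup>2"]
    have q: "(?q x)\<^sup>2 * (\<zeta> x)\<^sup>2 * (w x)\<^sup>2 \<le> (M\<^sub>w * \<mu>\<^sub>Q + M\<^sub>Q)\<^sup>2 * M\<^sub>w\<^sup>2 * (\<zeta> x)\<^sup>2"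
      by (simp add: mult_ac)
    have "K a w Q x * ?H x * ?n x * (\<zeta> x)\<^sup>2 + K a w Q x * ?N x * ((norm (gradient \<zeta> x))\<^sup>2
        + (?q x)\<^sup>2 * (\<zeta> x)\<^sup>2 * (w x)\<^sup>2) \<le> F x + G x"
      unfolding F_def G_def using q K_nonneg by (intro add_left_mono mult_left_mono) auto
    from mult_left_mono[OF this, of "(w x)\<^sup>2"]
    have "R x \<le> (w x)\<^sup>2 * (F x + G x)" by (simp add: R_def algebra_simps)
    also have "\<dots> \<le> M\<^sub>w\<^sup>2 * (F x + G x)"
      using w2 unfolding F_def G_def
      by (intro mult_right_mono add_nonneg_nonneg mult_nonneg_nonneg K_nonneg powr0_nonneg) auto
    finally show ?thesis .
  qed (use x in \<open>simp add: R_def F_def G_def outside\<close>)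
  ultimately have "(LINT x:U|lborel. L x) \<le> ?C * M\<^sub>w\<^sup>2 * ((LINT x:U|lborel. F x) + (LINT x:U|lborel. G x))"
    by (rule R_bound)
  then have "(LINT x:U|lborel. L x) \<le> ?C * M\<^sub>w\<^sup>2 * (LINT x:U|lborel. F x) + ?C * M\<^sub>w\<^sup>2 * (LINT x:U|lborel. G x)"
    by (simp only: distrib_left)
  \<comment> \<open>The last two terms of the claim are nonnegative, the first of them because
    \<open>s \<ge> 1\<close>, and are added on the right.\<close>
  moreover have "0 \<le> ?C * sgn (s - 1) * M\<^sub>w\<^sup>2 * (LINT x:U|lborel. K a w Q x * ?H x * (\<zeta> x)\<^sup>2)"
    using C assms(3) K_nonneg by (intro mult_nonneg_nonneg nonneg) (auto simp: sgn_if)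
  moreover have "0 \<le> ?C * measure lborel U * (M\<^sub>w\<^sup>2 * M\<^sub>Q) powr (2 * s + 2) * (1 + M\<^sub>w\<^sup>2 * M\<^sub>Q) powr (2 * s)"
    using C by (intro mult_nonneg_nonneg) auto
  ultimately show "let M\<^sub>w = (SUP x\<in>supp U \<zeta>. \<bar>w x\<bar>);
           M\<^sub>Q = (SUP x\<in>U. norm (Q x));
           \<mu>\<^sub>Q = (SUP x\<in>U. norm (jacobian Q (at x)))
       in
       (LINT x:U|lborel. K a w Q x * norm (gradient w x) powr (2 * s + 2) * (\<zeta> x)\<^sup>2)
         \<le> ?C * M\<^sub>w\<^sup>2 * (LINT x:U|lborel. K a w Q x * (norm (hessian w x))\<^sup>2
                 * norm (gradient w x) powr0 (2 * s - 2) * (\<zeta> x)\<^sup>2)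
           + ?C * M\<^sub>w\<^sup>2 * (LINT x:U|lborel. K a w Q x * norm (gradient w x) powr (2 * s)
                 * ((norm (gradient \<zeta> x))\<^sup>2 + (M\<^sub>w * \<mu>\<^sub>Q + M\<^sub>Q)\<^sup>2 * M\<^sub>w\<^sup>2 * (\<zeta> x)\<^sup>2))
           + ?C * sgn (s - 1) * M\<^sub>w\<^sup>2 * (LINT x:U|lborel. K a w Q x * (norm (hessian w x))\<^sup>2 * (\<zeta> x)\<^sup>2)
           + ?C * measure lborel U * (M\<^sub>w\<^sup>2 * M\<^sub>Q) powr (2 * s + 2) * (1 + M\<^sub>w\<^sup>2 * M\<^sub>Q) powr (2 * s)"
    unfolding Let_def M\<^sub>w_def[symmetric] M\<^sub>Q_def[symmetric] \<mu>\<^sub>Q_def[symmetric]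
      L_def[symmetric] F_def[symmetric] G_def[symmetric] by linarith
qed

end
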